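(* Let $m,d,e\geq 1$ and let $S_d(x):=\sum_{f\mid d}\mu(f)x^{d/f}\in\mathbb{Z}[x]$. (1) If $d$ and $e$ are primewise congruent modulo $m$, then $S_d(x)\equiv S_e(x)\bmod x^m-1$. (2) If $d$ and $e$ are primewise congruent modulo $2m$, then $S_d(x)\equiv S_e(x)\bmod x^m+1$.
   Context: $\mu$ is the Möbius function. Positive integers $d,e$ are primewise congruent modulo $m$ if $d=p_1^{e_1}\cdots p_k^{e_k}$ and $e=q_1^{f_1}\cdots q_k^{f_k}$ for some $k\geq1$ and primes $p_i,q_i$ with $e_i=f_i$ and $p_i\equiv q_i\bmod m$ for each $i$, and $p_i\neq p_j$, $q_i\neq q_j$ for $i\neq j$. Congruence of polynomials modulo $g(x)$ means the difference is divisible by $g(x)$ in $\mathbb{Z}[x]$. *)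

theory Defs
  imports
    "HOL-Computational_Algebra.Computational_Algebra"
    "HOL-Number_Theory.Cong"
begin

definition moebius_mu :: "nat \<Rightarrow> int" where
  "moebius_mu n = (if squarefree n then (-1) ^ card (prime_factors n) else 0)"

text \<open>
  A single exponent function \<open>a\<close> serves for both factorizations, as corresponding exponents are
  required to be equal. Exponents may be zero; since zero exponents can be dropped from both
  factorizations at once, the only effect is that 1 is primewise congruent to itself.
\<close>

definition primewise_cong :: "nat \<Rightarrow> nat \<Rightarrow> nat \<Rightarrow> bool" where
  "primewise_cong m d e \<longleftrightarrow>
     (\<exists>(k::nat) (p::nat \<Rightarrow> nat) (q::nat \<Rightarrow> nat) (a::nat \<Rightarrow> nat).
        k \<ge> 1 \<and>
        (\<forall>i\<in>{1..k}. prime (p i) \<and> prime (q i) \<and> [p i = q i] (mod m)) \<and>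
        inj_on p {1..k} \<and> inj_on q {1..k} \<and>
        d = (\<Prod>i=1..k. p i ^ a i) \<and>
        e = (\<Prod>i=1..k. q i ^ a i))"

definition S_poly :: "nat \<Rightarrow> int poly" where
  "S_poly d = (\<Sum>f | f dvd d. monom (moebius_mu f) (d div f))"

definition poly_cong :: "int poly \<Rightarrow> int poly \<Rightarrow> int poly \<Rightarrow> bool" where
  "poly_cong g A B \<longleftrightarrow> g dvd (A - B)"

end

theory Submission
  imports Defs
begin

text \<open>
  The terms of \<open>S\<^sub>d\<close> with nonzero coefficient are indexed by the sets of primes dividing \<open>d\<close>.
  If \<open>d\<close> and \<open>e\<close> are primewise congruent modulo \<open>m\<close>, corresponding terms have the same sign and
  their exponents are congruent modulo \<open>m\<close>, so the terms agree modulo \<open>x\<^sup>m - 1\<close>. The second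
  statement is the first one for \<open>2m\<close>, because \<open>x\<^sup>m + 1\<close> divides \<open>x\<^bsup>2m\<^esup> - 1\<close>.
\<close>

lemma prime_factors_prod_primes:
  fixes p :: "'b \<Rightarrow> nat"
  assumes "finite J" and "\<And>i. i \<in> J \<Longrightarrow> prime (p i)"
  shows "prime_factors (prod p J) = p ` J"
proof -
  have "prime_factors (prod p J) = (\<Union>i\<in>J. prime_factors (p i))"
    using assms by (subst prime_factors_prod) (force dest: prime_gt_0_nat)+
  also have "\<dots> = p ` J"
    using assms(2) by (auto simp: prime_factorization_prime)
  finally show ?thesis .
qed

lemma squarefree_prod_primes:
  fixes p :: "'b \<Rightarrow> nat"
  assumes "inj_on p J" and "\<And>i. i \<in> J \<Longrightarrow> prime (p i)"
  shows "squarefree (prod p J)"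
  using assms
  by (intro squarefree_prod_coprime)
     (auto intro: primes_coprime squarefree_prime dest: inj_onD)

text \<open>Every prime factor of a squarefree number has multiplicity 1, so the exponents disappear
  from its prime factorization.\<close>

lemma squarefree_eq_prod_prime_factors:
  fixes n :: nat
  assumes "squarefree n"
  shows "n = \<Prod>(prime_factors n)"
proof -
  have n: "n \<noteq> 0"
    using assms by (metis not_squarefree_0)
  have "n = (\<Prod>p\<in>prime_factors n. p ^ multiplicity p n)"
    using n by (intro prime_factorization_nat) auto
  also have "\<dots> = \<Prod>(prime_factors n)"
    using assms n by (intro prod.cong) (auto simp: squarefree_factorial_semiring')
  finally show ?thesis .
qed

lemma moebius_mu_prod_primes:
  assumes "finite J" and "inj_on p J" and "\<And>i. i \<in> J \<Longrightarrow> prime (p i)"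
  shows "moebius_mu (prod p J) = (-1) ^ card J"
  using assms
  by (simp add: moebius_mu_def squarefree_prod_primes prime_factors_prod_primes card_image)

text \<open>Positive exponents make every product of distinct \<open>p i\<close> a divisor.
  Conversely, a squarefree divisor is the product of its prime factors, all of which occur among the
  \<open>p i\<close>. This turns a sum over divisors into a sum over index sets.\<close>

lemma bij_betw_Pow_squarefree_divisors:
  fixes p a :: "'b \<Rightarrow> nat"
  assumes "finite I" and inj: "inj_on p I" and pr: "\<And>i. i \<in> I \<Longrightarrow> prime (p i)"
    and a: "\<And>i. i \<in> I \<Longrightarrow> a i > 0"
  shows "bij_betw (prod p) (Pow I) {f. f dvd (\<Prod>i\<in>I. p i ^ a i) \<and> squarefree f}"
    (is "bij_betw _ _ {f. f dvd ?d \<and> _}")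
proof (rule bij_betwI')
  fix J K assume "J \<in> Pow I" "K \<in> Pow I"
  then have JK: "J \<subseteq> I" "K \<subseteq> I" and fin: "finite J" "finite K"
    using \<open>finite I\<close> by (auto dest: finite_subset)
  have "p ` J = p ` K" if "prod p J = prod p K"
    using that prime_factors_prod_primes[of J p] prime_factors_prod_primes[of K p] fin JK pr
    by (metis subsetD)
  then show "prod p J = prod p K \<longleftrightarrow> J = K"
    using JK inj by (auto simp: inj_on_image_eq_iff)
next
  fix J assume "J \<in> Pow I"
  then have J: "J \<subseteq> I" by auto
  have "prod p J dvd (\<Prod>i\<in>J. p i ^ a i)"
    using J a by (intro prod_dvd_prod) (auto intro: dvd_power)
  also have "\<dots> dvd ?d"
    using J \<open>finite I\<close> by (intro prod_dvd_prod_subset)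
  finally show "prod p J \<in> {f. f dvd ?d \<and> squarefree f}"
    using J inj pr by (auto intro!: squarefree_prod_primes intro: inj_on_subset)
next
  fix f assume "f \<in> {f. f dvd ?d \<and> squarefree f}"
  then have f: "f dvd ?d" "squarefree f" by auto
  have "prime_factors f \<subseteq> p ` I"
  proof
    fix q assume "q \<in> prime_factors f"
    then have q: "prime q" "q dvd ?d"
      using f(1) by (auto intro: dvd_trans)
    then obtain i where "i \<in> I" "q dvd p i ^ a i"
      using \<open>finite I\<close> by (auto simp: prime_dvd_prod_iff)
    then show "q \<in> p ` I"
      using q pr by (metis image_eqI prime_dvd_power primes_dvd_imp_eq)
  qed
  then obtain J where J: "J \<subseteq> I" "prime_factors f = p ` J"
    by (meson subset_imageE)
  then have "f = prod p J"
    using squarefree_eq_prod_prime_factors[OF f(2)] inj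
    by (simp add: prod.reindex inj_on_subset)
  with J show "\<exists>J\<in>Pow I. f = prod p J" by auto
qed

text \<open>The index set and the signs depend only on \<open>I\<close>, and the primes enter only
  as bases in the exponents of the monomials. Expansions for two families of primes with the same
  \<open>a\<close> can therefore be compared term by term.\<close>

lemma S_poly_prod_prime_powers:
  fixes p a :: "'b \<Rightarrow> nat"
  assumes "finite I" and inj: "inj_on p I" and pr: "\<And>i. i \<in> I \<Longrightarrow> prime (p i)"
    and a: "\<And>i. i \<in> I \<Longrightarrow> a i > 0"
  shows "S_poly (\<Prod>i\<in>I. p i ^ a i) =
    (\<Sum>J\<in>Pow I. monom ((-1) ^ card J) (\<Prod>i\<in>I. p i ^ (if i \<in> J then a i - 1 else a i)))"
    (is "S_poly ?d = (\<Sum>J\<in>_. monom _ (?r J))")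
proof -
  have "?d > 0"
    using pr by (intro prod_pos) (auto intro: prime_gt_0_nat)
  then have "S_poly ?d = (\<Sum>f | f dvd ?d \<and> squarefree f. monom (moebius_mu f) (?d div f))"
    unfolding S_poly_def by (intro sum.mono_neutral_right) (auto simp: moebius_mu_def)
  also have "\<dots> = (\<Sum>J\<in>Pow I. monom (moebius_mu (prod p J)) (?d div prod p J))"
    using bij_betw_Pow_squarefree_divisors[OF assms]
    by (intro sum.reindex_bij_betw[symmetric])
  also have "\<dots> = (\<Sum>J\<in>Pow I. monom ((-1) ^ card J) (?r J))"
  proof (rule sum.cong[OF refl])
    fix J assume "J \<in> Pow I"
    then have J: "J \<subseteq> I" "finite J"
      using \<open>finite I\<close> by (auto dest: finite_subset)
    \<comment> \<open>Padding with factors 1 lets this product be multiplied with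
      \<open>?r J\<close> index by index over \<open>I\<close>.\<close>
    have "prod p J = (\<Prod>i\<in>I. if i \<in> J then p i else 1)"
      using J \<open>finite I\<close> by (simp add: prod.If_cases Int_absorb1)
    then have "prod p J * ?r J = (\<Prod>i\<in>I. (if i \<in> J then p i else 1) * p i ^ (if i \<in> J then a i - 1 else a i))"
      by (simp add: prod.distrib)
    also have "\<dots> = ?d"
      \<comment> \<open>Positivity of \<open>a i\<close> ensures that the truncated difference
        \<open>a i - 1\<close> really lowers the exponent by one.\<close>
      using a by (intro prod.cong) (auto simp flip: power_Suc)
    finally have "?d = prod p J * ?r J" ..
    moreover have "prod p J > 0"
      using J pr by (intro prod_pos) (blast intro: prime_gt_0_nat)
    ultimately have "?d div prod p J = ?r J" by simp
    moreover have "moebius_mu (prod p J) = (-1) ^ card J"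
      using J inj pr by (intro moebius_mu_prod_primes) (auto intro: inj_on_subset)
    ultimately show "monom (moebius_mu (prod p J)) (?d div prod p J) = monom ((-1) ^ card J) (?r J)"
      by simp
  qed
  finally show ?thesis .
qed

text \<open>For \<open>v = u + m * k\<close> the difference is a multiple of
  \<open>monom 1 m ^ k - 1\<close>, which a geometric sum factors. Exchanging \<open>u\<close> and
  \<open>v\<close> only changes the sign.\<close>

lemma monom_minus_one_dvd_monom_diff:
  fixes c :: "'a::comm_ring_1"
  assumes "[u = v] (mod m)"
  shows "monom 1 m - 1 dvd monom c u - monom c v"
  using assms
proof (induction u v rule: linorder_wlog)
  case (le u v)
  then obtain k where v: "v = u + m * k"
    by (metis cong_le_nat cong_sym mult.commute add.commute)
  have "monom c u - monom c v = monom c u * (1 - monom 1 m ^ k)"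
    by (simp add: v monom_power mult_monom algebra_simps)
  also have "\<dots> = - monom c u * (monom 1 m ^ k - 1)"
    by (simp add: algebra_simps)
  also have "monom 1 m - 1 dvd \<dots>"
    by (subst power_diff_1_eq) (rule dvd_mult, rule dvd_triv_left)
  finally show ?case .
next
  case (sym u v)
  then show ?case
    by (metis cong_sym dvd_minus_iff minus_diff_eq)
qed

lemma primewise_cong_imp_poly_cong:
  assumes "primewise_cong m d e"
  shows "poly_cong (monom 1 m - 1) (S_poly d) (S_poly e)"
proof -
  obtain k p q a where
    pq: "\<forall>i\<in>{1..k::nat}. prime (p i) \<and> prime (q i) \<and> [p i = q i] (mod m)"
    and inj: "inj_on p {1..k}" "inj_on q {1..k}"
    and d: "d = (\<Prod>i=1..k. p i ^ a i)" and e: "e = (\<Prod>i=1..k. q i ^ a i)"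
    using assms unfolding primewise_cong_def by blast
  \<comment> \<open>The expansion of \<open>S_poly\<close> requires positive exponents, so indices
    with \<open>a i = 0\<close> are dropped from both products at once. \<open>I\<close> is empty
    when \<open>d = e = 1\<close>.\<close>
  define I where "I = {i\<in>{1..k}. a i > 0}"
  have I: "finite I" "I \<subseteq> {1..k}" by (auto simp: I_def)
  have "d = (\<Prod>i\<in>I. p i ^ a i)" "e = (\<Prod>i\<in>I. q i ^ a i)"
    unfolding d e I_def by (auto intro!: prod.mono_neutral_right)
  moreover have "inj_on p I" "inj_on q I"
    using inj I(2) by (auto intro: inj_on_subset)
  moreover have "prime (p i)" "prime (q i)" "a i > 0" if "i \<in> I" for i
    using that pq by (auto simp: I_def)
  ultimately have "S_poly d - S_poly e = (\<Sum>J\<in>Pow I.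
      monom ((-1) ^ card J) (\<Prod>i\<in>I. p i ^ (if i \<in> J then a i - 1 else a i)) -
      monom ((-1) ^ card J) (\<Prod>i\<in>I. q i ^ (if i \<in> J then a i - 1 else a i)))"
    using I(1) by (simp add: S_poly_prod_prime_powers sum_subtractf)
  also have "monom 1 m - 1 dvd \<dots>"
    \<comment> \<open>For each \<open>J\<close> the two coefficients coincide, and the degrees are
      congruent modulo \<open>m\<close> factor by factor because \<open>p i\<close> and
      \<open>q i\<close> are.\<close>
    using pq I by (intro dvd_sum monom_minus_one_dvd_monom_diff cong_prod cong_pow) auto
  finally show ?thesis
    unfolding poly_cong_def .
qed

theorem theorem2p11:
  fixes m d e :: nat
  assumes "m \<ge> 1" and "d \<ge> 1" and "e \<ge> 1"
  shows "(primewise_cong m d e \<longrightarrow> poly_cong (monom 1 m - 1) (S_poly d) (S_poly e)) \<and>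
         (primewise_cong (2 * m) d e \<longrightarrow> poly_cong (monom 1 m + 1) (S_poly d) (S_poly e))"
proof (intro conjI impI)
  assume "primewise_cong m d e"
  then show "poly_cong (monom 1 m - 1) (S_poly d) (S_poly e)"
    by (rule primewise_cong_imp_poly_cong)
next
  assume "primewise_cong (2 * m) d e"
  then have "monom 1 (2 * m) - 1 dvd S_poly d - S_poly e"
    using primewise_cong_imp_poly_cong unfolding poly_cong_def by blast
  moreover have "monom 1 (2 * m) - 1 = (monom 1 m + 1) * (monom 1 m - 1 :: int poly)"
    by (simp add: ring_distribs mult_monom mult_2)
  ultimately show "poly_cong (monom 1 m + 1) (S_poly d) (S_poly e)"
    unfolding poly_cong_def by (metis dvd_mult_left)
qed

end
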